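(* Let $(l_n)_{n\ge0}$ be a well-indexed Lucas sequence. Then $(l_n)_{n\ge0}$ is log-concave at odd indices and log-convex at even ones; that is, for $n\ge1$, $l_n^2\ge l_{n-1}l_{n+1}$ if $n$ is odd and $l_n^2\le l_{n-1}l_{n+1}$ if $n$ is even.
   Context: A generalized Lucas sequence is a sequence $(l_n)_{n\ge0}$ of real numbers satisfying $l_n=l_{n-1}+l_{n-2}$ for all $n\ge2$. It is positive if $l_0,l_1>0$. A positive Lucas sequence is well-indexed if $0<2l_0\le l_1$. A sequence $(a_n)_{n\ge0}$ is log-concave at index $n$ if $a_n^2\ge a_{n-1}a_{n+1}$ and log-convex at index $n$ if $a_n^2\le a_{n-1}a_{n+1}$. *)

theory Defs
  imports Complex_Main
begin

definition generalized_lucas :: "(nat \<Rightarrow> real) \<Rightarrow> bool" where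
  "generalized_lucas l \<longleftrightarrow> (\<forall>n\<ge>2. l n = l (n - 1) + l (n - 2))"

definition positive_lucas :: "(nat \<Rightarrow> real) \<Rightarrow> bool" where
  "positive_lucas l \<longleftrightarrow> generalized_lucas l \<and> l 0 > 0 \<and> l 1 > 0"

definition well_indexed_lucas :: "(nat \<Rightarrow> real) \<Rightarrow> bool" where
  "well_indexed_lucas l \<longleftrightarrow> positive_lucas l \<and> 0 < 2 * l 0 \<and> 2 * l 0 \<le> l 1"

(* The next two notions are meaningful only for n \<ge> 1: at n = 0 the truncated
   subtraction gives n - 1 = 0, so uses must carry the bound n \<ge> 1. *)

definition log_concave_at :: "(nat \<Rightarrow> real) \<Rightarrow> nat \<Rightarrow> bool" where
  "log_concave_at a n \<longleftrightarrow> (a n)\<^sup>2 \<ge> a (n - 1) * a (n + 1)"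

definition log_convex_at :: "(nat \<Rightarrow> real) \<Rightarrow> nat \<Rightarrow> bool" where
  "log_convex_at a n \<longleftrightarrow> (a n)\<^sup>2 \<le> a (n - 1) * a (n + 1)"

end

theory Submission
  imports Defs
begin

text \<open>
  Log-concavity and log-convexity at \<open>n\<close> ask for the sign of the Cassini difference
  \<open>(l n)\<^sup>2 - l (n - 1) * l (n + 1)\<close>.  The recurrence makes this difference change sign, and
  keep its absolute value, whenever the index grows by one
  (\<open>generalized_lucas_cassini\<close>).  So everything is decided at index 1, where the difference
  is \<open>(l 1)\<^sup>2 - l 0 * l 1 - (l 0)\<^sup>2\<close>; being well-indexed makes it nonnegative
  (\<open>well_indexed_lucas_characteristic_nonneg\<close>).
\<close>

lemma generalized_lucas_Suc_Suc:
  assumes "generalized_lucas l"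
  shows "l (Suc (Suc n)) = l (Suc n) + l n"
  using assms[unfolded generalized_lucas_def, rule_format, of "Suc (Suc n)"] by simp

text \<open>
  Cassini's identity.  Expanding \<open>l (n + 3)\<close> and then \<open>l (n + 2)\<close> by the recurrence turns
  \<open>(l (n + 2))\<^sup>2 - l (n + 1) * l (n + 3)\<close> into \<open>l n * l (n + 2) - (l (n + 1))\<^sup>2\<close>, the
  negative of the preceding difference.
\<close>

lemma generalized_lucas_cassini:
  assumes "generalized_lucas l"
  shows "(l (Suc n))\<^sup>2 - l n * l (Suc (Suc n)) = (-1) ^ n * ((l 1)\<^sup>2 - l 0 * l 1 - (l 0)\<^sup>2)"
proof (induction n)
  case 0
  show ?case
    using generalized_lucas_Suc_Suc[OF assms, of 0] by (simp add: algebra_simps power2_eq_square)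
next
  case (Suc n)
  have "(l (Suc (Suc n)))\<^sup>2 - l (Suc n) * l (Suc (Suc (Suc n)))
      = - ((l (Suc n))\<^sup>2 - l n * l (Suc (Suc n)))"
    by (simp add: generalized_lucas_Suc_Suc[OF assms] algebra_simps power2_eq_square)
  then show ?case
    using Suc.IH by simp
qed

text \<open>
  The quadratic form is \<open>l 1 * (l 1 - l 0) - (l 0)\<^sup>2\<close>, and \<open>l 1 \<ge> 2 * l 0\<close> makes the product
  at least \<open>2 * (l 0)\<^sup>2\<close>.
\<close>

lemma well_indexed_lucas_characteristic_nonneg:
  assumes "well_indexed_lucas l"
  shows "(l 1)\<^sup>2 - l 0 * l 1 - (l 0)\<^sup>2 \<ge> 0"
proof -
  have pos: "0 < l 0" and le: "2 * l 0 \<le> l 1"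
    using assms by (auto simp: well_indexed_lucas_def)
  have "l 0 * l 0 \<le> (2 * l 0) * l 0"
    using pos by simp
  also have "\<dots> \<le> l 1 * (l 1 - l 0)"
    using pos le by (intro mult_mono) auto
  finally show ?thesis
    by (simp add: algebra_simps power2_eq_square)
qed

theorem theorem5p2:
  fixes l :: "nat \<Rightarrow> real"
  assumes "well_indexed_lucas l"
  shows "\<forall>n\<ge>1. (odd n \<longrightarrow> log_concave_at l n) \<and> (even n \<longrightarrow> log_convex_at l n)"
proof (intro allI impI)
  fix n :: nat
  assume "n \<ge> 1"
  then obtain m where n: "n = Suc m"
    by (cases n) auto
  have "generalized_lucas l"
    using assms by (simp add: well_indexed_lucas_def positive_lucas_def)
  note cassini = generalized_lucas_cassini[OF this, of m]
  note nonneg = well_indexed_lucas_characteristic_nonneg[OF assms]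
  show "(odd n \<longrightarrow> log_concave_at l n) \<and> (even n \<longrightarrow> log_convex_at l n)"
  proof (cases "even m")
    case True
    then have "log_concave_at l n"
      using cassini nonneg by (simp add: n log_concave_at_def)
    with True show ?thesis
      by (simp add: n)
  next
    case False
    then have "log_convex_at l n"
      using cassini nonneg by (simp add: n log_convex_at_def)
    with False show ?thesis
      by (simp add: n)
  qed
qed

end
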